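(* Let $n\ge 3$, $m\ge 2$, and let $f_i:\mathbb{R}^n\to\mathbb{R}$, $f_i(x)=x^\top A_i x+2b_i^\top x+c_i$, $i\in[m]$, be quadratic functions. Let $S=\{x\in\mathbb{R}^n: f_i(x)<0,\ i\in[m]\}$. Suppose that the associated homogeneous quadratic map $f^h:\mathbb{R}^{n+1}\to\mathbb{R}^m$ satisfies hidden hyperplane convexity. If $S\neq\emptyset$ and $\mathrm{conv}(S)\neq\mathbb{R}^n$, then $$\mathrm{conv}(S)=\bigcap_{\lambda\in\Omega}S_\lambda .$$
   Context: $[m]=\{1,\dots,m\}$; $A_i$ is a symmetric real $n\times n$ matrix, $b_i\in\mathbb{R}^n$, $c_i\in\mathbb{R}$. Put $Q_i=\begin{bmatrix}A_i & b_i\\ b_i^\top & c_i\end{bmatrix}$. The associated homogeneous quadratic map is $f^h=(f_1^h,\ldots,f_m^h)$ with $f_i^h(\hat x)=\hat x^\top Q_i\hat x$ for $\hat x\in\mathbb{R}^{n+1}$. It satisfies hidden hyperplane convexity (HHC) if for every linear hyperplane ($n$-dimensional linear subspace) $H\subseteq\mathbb{R}^{n+1}$ the set $\{f^h(\hat x):\hat x\in H\}\subseteq\mathbb{R}^m$ is convex. $\mathbb{R}^m_+$ is the nonnegative orthant. For $\lambda\in\mathbb{R}^m_+$: $Q_\lambda=\sum_{i=1}^m\lambda_iQ_i$ and $S_\lambda=\{x\in\mathbb{R}^n:\sum_{i=1}^m\lambda_if_i(x)<0\}$. Finally $\Omega=\{\lambda\in\mathbb{R}^m_+\setminus\{0\}: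 \mathrm{conv}(S)\subseteq S_\lambda$ and $Q_\lambda$ has at most one negative eigenvalue$\}$. *)

theory Defs
  imports "HOL-Analysis.Analysis"
begin

text \<open>
  Vectors in \<open>\<real>\<^sup>n\<close> are of type \<open>real ^ 'n\<close> with \<open>n = CARD('n)\<close>.  The homogenised space
  \<open>\<real>\<^sup>n\<^sup>+\<^sup>1\<close> is \<open>real ^ ('n option)\<close>: coordinate \<open>Some k\<close> is the \<open>k\<close>-th original coordinate and
  \<open>None\<close> is the additional one.
\<close>

definition quad :: "real^'n^'n \<Rightarrow> real^'n \<Rightarrow> real \<Rightarrow> real^'n \<Rightarrow> real" where
  "quad A b c x = x \<bullet> (A *v x) + 2 * (b \<bullet> x) + c"

definition sublevel :: "('m::finite \<Rightarrow> real^'n^'n) \<Rightarrow> ('m \<Rightarrow> real^'n) \<Rightarrow> ('m \<Rightarrow> real) \<Rightarrow> (real^'n) set"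
  where "sublevel A b c = {x. \<forall>i. quad (A i) (b i) (c i) x < 0}"

definition hom_mat :: "real^'n^'n \<Rightarrow> real^'n \<Rightarrow> real \<Rightarrow> real^('n option)^('n option)" where
  "hom_mat A b c = (\<chi> i j.
     case i of
       Some k \<Rightarrow> (case j of Some l \<Rightarrow> A $ k $ l | None \<Rightarrow> b $ k)
     | None \<Rightarrow> (case j of Some l \<Rightarrow> b $ l | None \<Rightarrow> c))"

definition hom_map ::
  "('m::finite \<Rightarrow> real^'n^'n) \<Rightarrow> ('m \<Rightarrow> real^'n) \<Rightarrow> ('m \<Rightarrow> real) \<Rightarrow> real^('n option) \<Rightarrow> real^'m" where
  "hom_map A b c y = (\<chi> i. y \<bullet> (hom_mat (A i) (b i) (c i) *v y))"

definition hidden_hyperplane_convex :: "('a::euclidean_space \<Rightarrow> 'b::real_vector) \<Rightarrow> bool" where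
  "hidden_hyperplane_convex g \<longleftrightarrow>
     (\<forall>H. subspace H \<and> dim H + 1 = DIM('a) \<longrightarrow> convex (g ` H))"

definition agg_mat ::
  "('m::finite \<Rightarrow> real^'n^'n) \<Rightarrow> ('m \<Rightarrow> real^'n) \<Rightarrow> ('m \<Rightarrow> real) \<Rightarrow> real^'m \<Rightarrow> real^('n option)^('n option)"
  where "agg_mat A b c w = (\<Sum>i\<in>UNIV. (w $ i) *\<^sub>R hom_mat (A i) (b i) (c i))"

definition agg_sublevel ::
  "('m::finite \<Rightarrow> real^'n^'n) \<Rightarrow> ('m \<Rightarrow> real^'n) \<Rightarrow> ('m \<Rightarrow> real) \<Rightarrow> real^'m \<Rightarrow> (real^'n) set"
  where "agg_sublevel A b c w = {x. (\<Sum>i\<in>UNIV. w $ i * quad (A i) (b i) (c i) x) < 0}"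

definition eigenspace :: "real^'k^'k \<Rightarrow> real \<Rightarrow> (real^'k) set" where
  "eigenspace M \<mu> = {v. M *v v = \<mu> *\<^sub>R v}"

definition eigenvalues :: "real^'k^'k \<Rightarrow> real set" where
  "eigenvalues M = {\<mu>. \<exists>v. v \<noteq> 0 \<and> M *v v = \<mu> *\<^sub>R v}"

text \<open>
  Negative eigenvalues are counted with multiplicity.  The definition is meant for symmetric
  matrices, where the geometric multiplicity used here is also the algebraic one.
\<close>

definition num_neg_eigenvalues :: "real^'k^'k \<Rightarrow> nat" where
  "num_neg_eigenvalues M = (\<Sum>\<mu> | \<mu> \<in> eigenvalues M \<and> \<mu> < 0. dim (eigenspace M \<mu>))"

text \<open>The sum above is over a finite set, so its default value for infinite sets plays no role.\<close>

lemma finite_eigenvalues: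
  fixes M :: "real^'k^'k"
  assumes sym: "transpose M = M"
  shows "finite (eigenvalues M)"
proof -
  define v where "v \<mu> = (SOME v. v \<noteq> 0 \<and> M *v v = \<mu> *\<^sub>R v)" for \<mu>
  have v: "v \<mu> \<noteq> 0 \<and> M *v v \<mu> = \<mu> *\<^sub>R v \<mu>" if "\<mu> \<in> eigenvalues M" for \<mu>
    using that unfolding v_def eigenvalues_def mem_Collect_eq by (rule_tac someI_ex)
  have orth: "v \<mu> \<bullet> v \<nu> = 0"
    if "\<mu> \<in> eigenvalues M" "\<nu> \<in> eigenvalues M" "\<mu> \<noteq> \<nu>" for \<mu> \<nu>
  proof -
    have "(M *v v \<mu>) \<bullet> v \<nu> = v \<mu> \<bullet> (M *v v \<nu>)"
      by (metis dot_lmul_matrix inner_commute sym transpose_matrix_vector)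
    then have "\<mu> * (v \<mu> \<bullet> v \<nu>) = \<nu> * (v \<mu> \<bullet> v \<nu>)"
      using v that by simp
    then show ?thesis using that by simp
  qed
  have inj: "inj_on v (eigenvalues M)"
    by (rule inj_onI) (metis orth v inner_eq_zero_iff)
  have "pairwise orthogonal (v ` eigenvalues M)"
    unfolding pairwise_def orthogonal_def using orth by blast
  moreover have "0 \<notin> v ` eigenvalues M"
    using v by force
  ultimately have "independent (v ` eigenvalues M)"
    by (rule pairwise_orthogonal_independent)
  then have "finite (v ` eigenvalues M)"
    by (rule independent_imp_finite)
  then show ?thesis
    using inj finite_image_iff by blast
qed

definition good_aggregations ::
  "('m::finite \<Rightarrow> real^'n^'n) \<Rightarrow> ('m \<Rightarrow> real^'n) \<Rightarrow> ('m \<Rightarrow> real) \<Rightarrow> (real^'m) set" where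
  "good_aggregations A b c =
     {w. (\<forall>i. 0 \<le> w $ i) \<and> w \<noteq> 0 \<and>
         convex hull (sublevel A b c) \<subseteq> agg_sublevel A b c w \<and>
         num_neg_eigenvalues (agg_mat A b c w) \<le> 1}"

end

theory Submission
  imports Defs
begin

text \<open>
  The inclusion from left to right is part of the definition of a good aggregation.  Conversely, let
  \<open>y\<close> lie outside the open convex set \<open>conv S\<close>.  Some affine hyperplane through \<open>y\<close> has \<open>conv S\<close>
  strictly on one side; its homogenisation is a linear hyperplane \<open>H\<close>, with normal vector \<open>a\<close> say,
  on which the components of \<open>f\<^sup>h\<close> are never all negative (\<open>hyperplane_misses_cone\<close>).
  Hidden hyperplane convexity makes \<open>f\<^sup>h(H)\<close> convex, so it can be separated from the open negative
  orthant.  The separating vector \<open>w\<close> is nonzero and nonnegative, and \<open>Q\<^sub>w\<close> is positive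
  semidefinite on \<open>H\<close> (\<open>convex_misses_negative_orthant\<close>).  As the homogenisation of \<open>y\<close> lies in
  \<open>H\<close>, the point \<open>y\<close> is not in \<open>S\<^sub>w\<close>.

  Semidefiniteness on a hyperplane makes \<open>w\<close> a good aggregation.  It leaves room for at most one
  negative eigenvalue, because two orthogonal eigenvectors with negative eigenvalues would span a
  plane on which the form is negative definite, and this plane meets \<open>H\<close> outside the origin
  (\<open>num_neg_eigenvalues_le_one\<close>).  It also splits the double cone \<open>Q\<^sub>w < 0\<close> along \<open>H\<close> into
  two nappes, each of which is convex (\<open>convex_nappe\<close>).  The homogenisation of \<open>S\<close> is in the cone,
  as \<open>w\<close> is nonzero and nonnegative, and it lies on one side of \<open>H\<close>; so it is in one nappe, and
  then so is that of \<open>conv S\<close>.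
\<close>

section \<open>Symmetric matrices that are positive semidefinite on a hyperplane\<close>

lemma symmetric_matrix_inner:
  fixes M :: "real^'k^'k"
  assumes "transpose M = M"
  shows "u \<bullet> (M *v v) = v \<bullet> (M *v u)"
  by (metis assms dot_lmul_matrix inner_commute transpose_matrix_vector)

lemma quadratic_form_combination:
  fixes M :: "real^'k^'k"
  assumes "transpose M = M"
  shows "(s *\<^sub>R u + t *\<^sub>R v) \<bullet> (M *v (s *\<^sub>R u + t *\<^sub>R v)) =
    s\<^sup>2 * (u \<bullet> (M *v u)) + 2 * (s * t) * (u \<bullet> (M *v v)) + t\<^sup>2 * (v \<bullet> (M *v v))"
  using symmetric_matrix_inner[OF assms, of v u]
  by (simp add: matrix_vector_right_distrib matrix_vector_mult_scaleR inner_add_left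
      inner_add_right power2_eq_square algebra_simps)

text \<open>
  If \<open>u\<close> and \<open>v\<close> are in the nappe, then some \<open>u - k v\<close> with \<open>k > 0\<close> lies in the
  hyperplane, where the form is nonnegative.  Expanding the form at this vector shows that
  \<open>u \<bullet> (M *v v)\<close> is negative, so the form is negative at all convex combinations.
\<close>

lemma convex_nappe:
  fixes M :: "real^'k^'k"
  assumes sym: "transpose M = M"
    and psd: "\<And>z. a \<bullet> z = 0 \<Longrightarrow> 0 \<le> z \<bullet> (M *v z)"
  shows "convex {z. a \<bullet> z < 0 \<and> z \<bullet> (M *v z) < 0}"
proof (rule convexI)
  fix u v :: "real^'k" and s t :: real
  assume "u \<in> {z. a \<bullet> z < 0 \<and> z \<bullet> (M *v z) < 0}" "v \<in> {z. a \<bullet> z < 0 \<and> z \<bullet> (M *v z) < 0}"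
    and st: "0 \<le> s" "0 \<le> t" "s + t = 1"
  then have u: "a \<bullet> u < 0" "u \<bullet> (M *v u) < 0" and v: "a \<bullet> v < 0" "v \<bullet> (M *v v) < 0"
    by auto
  define k where "k = (a \<bullet> u) / (a \<bullet> v)"
  have k: "k > 0"
    using u v by (simp add: k_def divide_neg_neg)
  have "a \<bullet> (1 *\<^sub>R u + (- k) *\<^sub>R v) = 0"
    using v by (simp add: k_def inner_add_right inner_diff_right)
  then have "0 \<le> u \<bullet> (M *v u) - 2 * k * (u \<bullet> (M *v v)) + k\<^sup>2 * (v \<bullet> (M *v v))"
    using psd[of "1 *\<^sub>R u + (- k) *\<^sub>R v"] unfolding quadratic_form_combination[OF sym] by simp
  moreover have "k\<^sup>2 * (v \<bullet> (M *v v)) < 0"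
    using k v by (simp add: mult_pos_neg)
  ultimately have "k * (u \<bullet> (M *v v)) < 0"
    using u by linarith
  then have uv: "u \<bullet> (M *v v) < 0"
    using k by (simp add: mult_less_0_iff)
  have "(s *\<^sub>R u + t *\<^sub>R v) \<bullet> (M *v (s *\<^sub>R u + t *\<^sub>R v)) < 0 \<and> a \<bullet> (s *\<^sub>R u + t *\<^sub>R v) < 0"
  proof (cases "s = 0")
    case True
    then show ?thesis using st v by simp
  next
    case False
    then have s: "s > 0" using st by simp
    have "s\<^sup>2 * (u \<bullet> (M *v u)) < 0" "2 * (s * t) * (u \<bullet> (M *v v)) \<le> 0"
        "t\<^sup>2 * (v \<bullet> (M *v v)) \<le> 0" "s * (a \<bullet> u) < 0" "t * (a \<bullet> v) \<le> 0"
      using s st u v uv by (auto simp: mult_pos_neg mult_nonneg_nonpos)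
    then show ?thesis
      unfolding quadratic_form_combination[OF sym] by (simp add: inner_add_right)
  qed
  then show "s *\<^sub>R u + t *\<^sub>R v \<in> {z. a \<bullet> z < 0 \<and> z \<bullet> (M *v z) < 0}"
    by simp
qed

text \<open>
  The vector \<open>(a \<bullet> v) u - (a \<bullet> u) v\<close> lies in the hyperplane, and the form would be negative there
  unless both coefficients vanish; but then \<open>u\<close> itself lies in the hyperplane.
\<close>

lemma no_orthogonal_negative_eigenvectors:
  fixes M :: "real^'k^'k"
  assumes sym: "transpose M = M"
    and psd: "\<And>z. a \<bullet> z = 0 \<Longrightarrow> 0 \<le> z \<bullet> (M *v z)"
    and u: "M *v u = \<mu> *\<^sub>R u" "\<mu> < 0" "u \<noteq> 0"
    and v: "M *v v = \<nu> *\<^sub>R v" "\<nu> < 0" "v \<noteq> 0"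
    and orth: "u \<bullet> v = 0"
  shows False
proof -
  have neg: "u \<bullet> (M *v u) < 0" "v \<bullet> (M *v v) < 0"
    using u v by (simp_all add: mult_neg_pos)
  let ?s = "a \<bullet> v" and ?t = "- (a \<bullet> u)"
  have "a \<bullet> (?s *\<^sub>R u + ?t *\<^sub>R v) = 0"
    by (simp add: inner_diff_right)
  then have "0 \<le> ?s\<^sup>2 * (u \<bullet> (M *v u)) + ?t\<^sup>2 * (v \<bullet> (M *v v))"
    using psd[of "?s *\<^sub>R u + ?t *\<^sub>R v"] orth v(1)
    unfolding quadratic_form_combination[OF sym] by simp
  moreover have "?s\<^sup>2 * (u \<bullet> (M *v u)) \<le> 0"
    using neg by (simp add: mult_nonneg_nonpos)
  ultimately have "0 \<le> ?t\<^sup>2 * (v \<bullet> (M *v v))"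
    by linarith
  then have "a \<bullet> u = 0"
    using neg by (simp add: zero_le_mult_iff)
  then show False
    using psd neg by fastforce
qed

lemma subspace_eigenspace: "subspace (eigenspace M \<mu>)"
  unfolding subspace_def eigenspace_def
  by (auto simp: matrix_vector_right_distrib matrix_vector_mult_scaleR scaleR_right_distrib)

lemma num_neg_eigenvalues_le_one:
  fixes M :: "real^'k^'k"
  assumes sym: "transpose M = M"
    and psd: "\<And>z. a \<bullet> z = 0 \<Longrightarrow> 0 \<le> z \<bullet> (M *v z)"
  shows "num_neg_eigenvalues M \<le> 1"
proof -
  define N where "N = {\<mu>. \<mu> \<in> eigenvalues M \<and> \<mu> < 0}"
  have no_two: False
    if "M *v u = \<mu> *\<^sub>R u" "\<mu> < 0" "u \<noteq> 0" "M *v v = \<nu> *\<^sub>R v" "\<nu> < 0" "v \<noteq> 0" "u \<bullet> v = 0"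
    for u v \<mu> \<nu>
    using no_orthogonal_negative_eigenvectors[OF sym psd] that by blast
  have unique: "\<mu> = \<nu>" if "\<mu> \<in> N" "\<nu> \<in> N" for \<mu> \<nu>
  proof (rule ccontr)
    assume "\<mu> \<noteq> \<nu>"
    from that obtain u v where uv: "u \<noteq> 0" "M *v u = \<mu> *\<^sub>R u" "v \<noteq> 0" "M *v v = \<nu> *\<^sub>R v"
      and neg: "\<mu> < 0" "\<nu> < 0"
      by (auto simp: N_def eigenvalues_def)
    have "\<nu> * (u \<bullet> v) = \<mu> * (u \<bullet> v)"
      using symmetric_matrix_inner[OF sym, of u v] uv by (simp add: inner_commute)
    then have "u \<bullet> v = 0"
      using \<open>\<mu> \<noteq> \<nu>\<close> by simp
    then show False
      using no_two uv neg by blast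
  qed
  have dim_le: "dim (eigenspace M \<mu>) \<le> 1" if "\<mu> \<in> N" for \<mu>
  proof -
    obtain B where B: "B \<subseteq> eigenspace M \<mu>" "pairwise orthogonal B" "independent B"
        "card B = dim (eigenspace M \<mu>)"
      using orthonormal_basis_subspace[OF subspace_eigenspace, of M \<mu>] by metis
    have "u = v" if "u \<in> B" "v \<in> B" for u v
    proof (rule ccontr)
      assume "u \<noteq> v"
      then have "u \<bullet> v = 0"
        using B(2) that by (auto simp: pairwise_def orthogonal_def)
      moreover have "u \<noteq> 0" "v \<noteq> 0"
        using B(3) that dependent_zero by auto
      ultimately show False
        using no_two[of u \<mu> v \<mu>] that B(1) \<open>\<mu> \<in> N\<close> by (auto simp: eigenspace_def N_def)
    qed
    then have "card B \<le> 1"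
      using card_le_Suc0_iff_eq[OF independent_imp_finite[OF B(3)]] by auto
    then show ?thesis
      using B(4) by simp
  qed
  have "N = {} \<or> (\<exists>\<mu>. N = {\<mu>})"
    using unique by blast
  then have "(\<Sum>\<mu>\<in>N. dim (eigenspace M \<mu>)) \<le> 1"
    using dim_le by auto
  then show ?thesis
    by (simp add: num_neg_eigenvalues_def N_def)
qed

section \<open>Separation from the negative orthant\<close>

text \<open>
  As \<open>0 \<in> C\<close>, the separating functional is bounded above on the orthant by some \<open>\<beta> \<le> 0\<close>, hence also on its closure.
  The points \<open>0\<close> and \<open>- e\<^sub>i\<close> of the closure give \<open>\<beta> = 0\<close> and nonnegative coordinates.
\<close>

lemma convex_misses_negative_orthant:
  fixes C :: "(real^'m) set"
  assumes C: "convex C" "0 \<in> C" and misses: "\<And>z. z \<in> C \<Longrightarrow> \<exists>i. 0 \<le> z $ i"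
  obtains w where "w \<noteq> 0" "\<And>i. 0 \<le> w $ i" "\<And>z. z \<in> C \<Longrightarrow> 0 \<le> w \<bullet> z"
proof -
  define P where "P = {z::real^'m. \<forall>i. z $ i < 0}"
  have "convex P"
    by (auto simp: P_def intro!: convexI convex_bound_lt)
  moreover have ne: "(- 1 :: real^'m) \<in> P"
    by (simp add: P_def)
  moreover have "P \<inter> C = {}"
    unfolding disjoint_iff P_def mem_Collect_eq using misses not_less by blast
  ultimately obtain w \<beta> where w: "w \<noteq> 0" and le: "\<And>z. z \<in> P \<Longrightarrow> w \<bullet> z \<le> \<beta>"
    and ge: "\<And>z. z \<in> C \<Longrightarrow> \<beta> \<le> w \<bullet> z"
    using separating_hyperplane_sets[of P C] C by blast
  have closure: "w \<bullet> z \<le> \<beta>" if "\<And>i. z $ i \<le> 0" for z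
  proof -
    have "((\<lambda>e. w \<bullet> (z - e *\<^sub>R 1)) \<longlongrightarrow> w \<bullet> (z - 0 *\<^sub>R 1)) (at_right 0)"
      by (intro tendsto_intros)
    moreover have "\<forall>\<^sub>F e in at_right 0. w \<bullet> (z - e *\<^sub>R 1) \<le> \<beta>"
      using eventually_at_right_less[of "0::real"]
    proof eventually_elim
      case (elim e)
      have "z $ i - e < 0" for i
        using that[of i] elim by linarith
      then show ?case
        by (intro le) (simp add: P_def)
    qed
    ultimately have "w \<bullet> (z - 0 *\<^sub>R 1) \<le> \<beta>"
      by (rule tendsto_upperbound) simp
    then show ?thesis by simp
  qed
  have "\<beta> \<ge> 0" "\<beta> \<le> 0"
    using closure[of 0] ge[OF C(2)] by auto
  moreover have "0 \<le> w $ i" for i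
  proof -
    have "(- axis i 1 :: real^'m) $ j \<le> 0" for j
      by (simp add: axis_def)
    then have "w \<bullet> (- axis i 1) \<le> \<beta>"
      by (rule closure)
    then show ?thesis
      using \<open>\<beta> \<le> 0\<close> by (simp add: inner_axis)
  qed
  ultimately show thesis
    using that[OF w] ge by force
qed

section \<open>Homogenisation\<close>

definition homogenise :: "real^'n \<Rightarrow> real \<Rightarrow> real^('n option)" where
  "homogenise x t = (\<chi> i. case i of Some k \<Rightarrow> x $ k | None \<Rightarrow> t)"

lemma sum_UNIV_option:
  fixes g :: "'n::finite option \<Rightarrow> 'b::comm_monoid_add"
  shows "(\<Sum>i\<in>UNIV. g i) = g None + (\<Sum>k\<in>UNIV. g (Some k))"
  by (simp add: UNIV_option_conv sum.reindex)

lemma homogenise_cases: obtains x t where "z = homogenise x t"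
proof
  show "z = homogenise (\<chi> k. z $ Some k) (z $ None)"
    by (simp add: homogenise_def vec_eq_iff split: option.split)
qed

lemma inner_homogenise: "homogenise x t \<bullet> homogenise y s = x \<bullet> y + t * s"
  by (simp add: homogenise_def inner_vec_def sum_UNIV_option)

lemma homogenise_linear:
  "u *\<^sub>R homogenise x t + v *\<^sub>R homogenise y s = homogenise (u *\<^sub>R x + v *\<^sub>R y) (u * t + v * s)"
  by (simp add: homogenise_def vec_eq_iff split: option.split)

lemma hom_mat_homogenise:
  "hom_mat A b c *v homogenise x t = homogenise (A *v x + t *\<^sub>R b) (b \<bullet> x + c * t)"
  by (simp add: hom_mat_def homogenise_def vec_eq_iff matrix_vector_mult_def sum_UNIV_option
      inner_vec_def algebra_simps split: option.split)

lemma hom_map_homogenise_1: "hom_map A b c (homogenise x 1) $ i = quad (A i) (b i) (c i) x"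
  by (simp add: hom_map_def hom_mat_homogenise inner_homogenise quad_def inner_add_right
      inner_commute)

lemma hom_map_scaleR: "hom_map A b c (r *\<^sub>R z) = r\<^sup>2 *\<^sub>R hom_map A b c z"
  by (simp add: hom_map_def vec_eq_iff matrix_vector_mult_scaleR power2_eq_square)

lemma transpose_hom_mat: "transpose A = A \<Longrightarrow> transpose (hom_mat A b c) = hom_mat A b c"
  by (auto simp: hom_mat_def transpose_def vec_eq_iff split: option.split)

lemma transpose_agg_mat:
  assumes "\<And>i. transpose (A i) = A i"
  shows "transpose (agg_mat A b c w) = agg_mat A b c w"
proof -
  have "hom_mat (A i) (b i) (c i) $ k $ l = hom_mat (A i) (b i) (c i) $ l $ k" for i k l
    using transpose_hom_mat[OF assms, of i "b i" "c i"]
    by (metis (no_types, lifting) transpose_def vec_lambda_beta)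
  then show ?thesis
    by (simp add: agg_mat_def transpose_def vec_eq_iff)
qed

lemma agg_mat_quadratic_form:
  fixes A :: "'m::finite \<Rightarrow> real^'n^'n"
  shows "z \<bullet> (agg_mat A b c w *v z) = w \<bullet> hom_map A b c z"
proof -
  have lin: "linear (\<lambda>M :: real^('n option)^('n option). z \<bullet> (M *v z))"
    by (rule linearI)
      (simp_all add: matrix_vector_mult_add_rdistrib inner_add_right
        flip: scaleR_matrix_vector_assoc)
  show ?thesis
    unfolding agg_mat_def hom_map_def inner_vec_def[of w]
    by (simp add: linear_sum[OF lin] flip: scaleR_matrix_vector_assoc)
qed

lemma agg_sublevel_iff: "x \<in> agg_sublevel A b c w \<longleftrightarrow> w \<bullet> hom_map A b c (homogenise x 1) < 0"
  by (simp add: agg_sublevel_def inner_vec_def hom_map_homogenise_1)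

lemma continuous_on_hom_map: "continuous_on S (\<lambda>z. hom_map A b c z $ i)"
  unfolding hom_map_def vec_lambda_beta by (intro continuous_intros)

lemma open_sublevel: "open (sublevel A b c)"
proof -
  have "continuous_on UNIV (\<lambda>x. quad (A i) (b i) (c i) x)" for i
    unfolding quad_def by (intro continuous_intros)
  then have "open (\<Inter>i\<in>UNIV. {x. quad (A i) (b i) (c i) x < 0})"
    by (intro open_INT ballI open_Collect_less continuous_on_const) simp_all
  moreover have "(\<Inter>i\<in>UNIV. {x. quad (A i) (b i) (c i) x < 0}) = sublevel A b c"
    by (auto simp: sublevel_def)
  ultimately show ?thesis by simp
qed

text \<open>
  A point of the homogenised hyperplane whose additional coordinate is nonzero scales to a point of
  the affine hyperplane through \<open>y\<close>, which misses the sublevel set.  If this coordinate is zero, all components of the map being negative is an open condition, so it would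
  persist after moving slightly towards \<open>homogenise y 1\<close>, which leads to the first case.
\<close>

lemma hyperplane_misses_cone:
  assumes misses: "\<And>x. x \<in> sublevel A b c \<Longrightarrow> \<alpha> \<bullet> x \<noteq> \<alpha> \<bullet> y"
    and z: "homogenise \<alpha> (- (\<alpha> \<bullet> y)) \<bullet> z = 0"
  shows "\<exists>i. 0 \<le> hom_map A b c z $ i"
proof (rule ccontr)
  let ?a = "homogenise \<alpha> (- (\<alpha> \<bullet> y))" and ?y = "homogenise y 1"
  assume "\<not> ?thesis"
  then have neg: "hom_map A b c z $ i < 0" for i
    by (simp add: not_le)
  have finite_point: False
    if H: "?a \<bullet> homogenise x t = 0" and t: "t \<noteq> 0"
      and lt: "\<And>i. hom_map A b c (homogenise x t) $ i < 0" for x t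
  proof -
    have "(1/t) *\<^sub>R homogenise x t = homogenise ((1/t) *\<^sub>R x) 1"
      using homogenise_linear[of "1/t" x t 0 0 0] t by simp
    then have "hom_map A b c (homogenise ((1/t) *\<^sub>R x) 1) $ i < 0" for i
      using lt[of i] t hom_map_scaleR[of A b c "1/t" "homogenise x t"]
      by (simp add: power_divide mult_pos_neg divide_neg_pos)
    then have "(1/t) *\<^sub>R x \<in> sublevel A b c"
      by (simp add: sublevel_def hom_map_homogenise_1)
    moreover have "\<alpha> \<bullet> ((1/t) *\<^sub>R x) = \<alpha> \<bullet> y"
      using H t by (simp add: inner_homogenise field_simps)
    ultimately show False
      using misses by blast
  qed
  obtain x t where zx: "z = homogenise x t"
    by (rule homogenise_cases)
  show False
  proof (cases "t = 0")
    case False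
    then show False
      using finite_point z neg zx by blast
  next
    case True
    have "((\<lambda>e. hom_map A b c (z + e *\<^sub>R ?y) $ i) \<longlongrightarrow> hom_map A b c (z + 0 *\<^sub>R ?y) $ i)
        (at_right 0)" for i
      by (rule continuous_on_tendsto_compose[OF continuous_on_hom_map[of UNIV]])
        (intro tendsto_intros, simp_all)
    then have "\<forall>\<^sub>F e in at_right 0. hom_map A b c (z + e *\<^sub>R ?y) $ i < 0" for i
      using neg[of i] by (intro order_tendstoD(2)) auto
    then have "\<forall>\<^sub>F e in at_right (0::real). (\<forall>i. hom_map A b c (z + e *\<^sub>R ?y) $ i < 0) \<and> 0 < e"
      by (intro eventually_conj eventually_all_finite eventually_at_right_less)
    then obtain e where e: "\<And>i. hom_map A b c (z + e *\<^sub>R ?y) $ i < 0" "0 < e"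
      using eventually_happens'[OF trivial_limit_at_right_real] by blast
    have "z + e *\<^sub>R ?y = homogenise (x + e *\<^sub>R y) e"
      using homogenise_linear[of 1 x t e y 1] zx True by simp
    moreover have "?a \<bullet> (z + e *\<^sub>R ?y) = 0"
      using z by (simp add: inner_add_right inner_homogenise)
    ultimately show False
      using finite_point e by (metis less_irrefl)
  qed
qed

section \<open>Convex hulls as intersections of aggregations\<close>

text \<open>
  Weak separation from \<open>y\<close> puts \<open>C\<close> into a closed half-space; being open, \<open>C\<close> lies in its interior.
\<close>

lemma strict_separation_open_convex:
  fixes C :: "'a::euclidean_space set"
  assumes "open C" "convex C" "C \<noteq> {}" "y \<notin> C"
  obtains \<alpha> where "\<alpha> \<noteq> 0" "\<And>x. x \<in> C \<Longrightarrow> \<alpha> \<bullet> x < \<alpha> \<bullet> y"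
proof -
  obtain \<alpha> \<beta> where "\<alpha> \<noteq> 0" "\<forall>x\<in>C. \<alpha> \<bullet> x \<le> \<beta>" "\<beta> \<le> \<alpha> \<bullet> y"
    using separating_hyperplane_sets[of C "{y}"] assms by auto
  then have "C \<subseteq> {x. \<alpha> \<bullet> x \<le> \<alpha> \<bullet> y}"
    by force
  then have "C \<subseteq> interior {x. \<alpha> \<bullet> x \<le> \<alpha> \<bullet> y}"
    using \<open>open C\<close> by (rule interior_maximal)
  then show thesis
    using that \<open>\<alpha> \<noteq> 0\<close> interior_halfspace_le[OF \<open>\<alpha> \<noteq> 0\<close>] by blast
qed

text \<open>
  The separation takes place in the image space, for the image of the homogenised separating
  hyperplane.  The nappe \<open>K\<close> of the resulting quadratic cone that lies on the side of the sublevel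
  set has a convex trace on the affine space of points \<open>homogenise x 1\<close>; this trace contains the
  sublevel set and hence its hull.
\<close>

lemma exists_good_aggregation_excluding:
  fixes A :: "'m::finite \<Rightarrow> real^'n^'n"
  assumes sym: "\<And>i. transpose (A i) = A i"
    and hhc: "hidden_hyperplane_convex (hom_map A b c)"
    and ne: "sublevel A b c \<noteq> {}"
    and y: "y \<notin> convex hull (sublevel A b c)"
  obtains w where "w \<in> good_aggregations A b c" "y \<notin> agg_sublevel A b c w"
proof -
  obtain \<alpha> where \<alpha>: "\<alpha> \<noteq> 0" "\<And>x. x \<in> convex hull (sublevel A b c) \<Longrightarrow> \<alpha> \<bullet> x < \<alpha> \<bullet> y"
    using strict_separation_open_convex[OF open_convex_hull[OF open_sublevel] convex_convex_hull _ y]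
      ne by auto
  have side: "\<alpha> \<bullet> x < \<alpha> \<bullet> y" if "x \<in> sublevel A b c" for x
    using \<alpha>(2) that hull_inc by metis
  define a where "a = homogenise \<alpha> (- (\<alpha> \<bullet> y))"
  have "a \<bullet> homogenise \<alpha> 0 \<noteq> 0"
    using \<alpha>(1) by (simp add: a_def inner_homogenise)
  then have "a \<noteq> 0"
    by force
  then have "dim {z. a \<bullet> z = 0} + 1 = DIM(real^('n option))"
    using dim_hyperplane[of a] DIM_positive[where 'a = "real^('n option)"] by simp
  then have "convex (hom_map A b c ` {z. a \<bullet> z = 0})"
    using hhc subspace_hyperplane unfolding hidden_hyperplane_convex_def by blast
  moreover have "hom_map A b c 0 = 0"
    using hom_map_scaleR[of A b c 0 0] by simp
  then have "0 \<in> hom_map A b c ` {z. a \<bullet> z = 0}"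
    by (force intro: image_eqI[of _ _ 0])
  moreover have "\<exists>i. 0 \<le> p $ i" if "p \<in> hom_map A b c ` {z. a \<bullet> z = 0}" for p
    using that hyperplane_misses_cone[of A b c \<alpha> y] side unfolding a_def by fastforce
  ultimately obtain w where w: "w \<noteq> 0" "\<And>i. 0 \<le> w $ i"
    and sep: "\<And>p. p \<in> hom_map A b c ` {z. a \<bullet> z = 0} \<Longrightarrow> 0 \<le> w \<bullet> p"
    using convex_misses_negative_orthant by metis
  let ?M = "agg_mat A b c w"
  have symM: "transpose ?M = ?M"
    using sym by (rule transpose_agg_mat)
  have psd: "0 \<le> z \<bullet> (?M *v z)" if "a \<bullet> z = 0" for z
    using sep that by (auto simp: agg_mat_quadratic_form)
  define K where "K = {z. a \<bullet> z < 0 \<and> z \<bullet> (?M *v z) < 0}"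
  have "convex K"
    unfolding K_def using symM psd by (rule convex_nappe)
  have "convex {x. homogenise x 1 \<in> K}"
  proof (rule convexI)
    fix x x' and s t :: real
    assume "x \<in> {x. homogenise x 1 \<in> K}" "x' \<in> {x. homogenise x 1 \<in> K}"
      and st: "0 \<le> s" "0 \<le> t" "s + t = 1"
    then have "s *\<^sub>R homogenise x 1 + t *\<^sub>R homogenise x' 1 \<in> K"
      using convexD[OF \<open>convex K\<close>] by simp
    then show "s *\<^sub>R x + t *\<^sub>R x' \<in> {x. homogenise x 1 \<in> K}"
      using st by (simp add: homogenise_linear)
  qed
  moreover have "sublevel A b c \<subseteq> {x. homogenise x 1 \<in> K}"
  proof
    fix x assume x: "x \<in> sublevel A b c"
    obtain i where "w $ i \<noteq> 0"
      using w(1) by (auto simp: vec_eq_iff)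
    then have "0 < w $ i"
      using w(2)[of i] by simp
    then have "(\<Sum>i\<in>UNIV. w $ i * quad (A i) (b i) (c i) x) < (\<Sum>i\<in>(UNIV::'m set). 0)"
      using x w(2)
      by (intro sum_strict_mono_ex1)
        (auto simp: sublevel_def mult_nonneg_nonpos less_imp_le intro!: bexI[of _ i] mult_pos_neg)
    then have "homogenise x 1 \<bullet> (?M *v homogenise x 1) < 0"
      by (simp add: agg_mat_quadratic_form inner_vec_def[of w] hom_map_homogenise_1)
    then show "x \<in> {x. homogenise x 1 \<in> K}"
      using side[OF x] by (simp add: K_def a_def inner_homogenise)
  qed
  ultimately have "convex hull (sublevel A b c) \<subseteq> {x. homogenise x 1 \<in> K}"
    by (rule hull_minimal[rotated])
  also have "\<dots> \<subseteq> agg_sublevel A b c w"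
    by (auto simp: K_def agg_sublevel_iff agg_mat_quadratic_form)
  finally have "w \<in> good_aggregations A b c"
    using w num_neg_eigenvalues_le_one[OF symM psd] by (auto simp: good_aggregations_def)
  moreover have "y \<notin> agg_sublevel A b c w"
    using psd[of "homogenise y 1"]
    by (simp add: agg_sublevel_iff agg_mat_quadratic_form a_def inner_homogenise)
  ultimately show thesis
    using that by blast
qed

theorem theorem2p9:
  fixes A :: "'m::finite \<Rightarrow> real^'n^'n" and b :: "'m \<Rightarrow> real^'n" and c :: "'m \<Rightarrow> real"
  assumes "CARD('n) \<ge> 3" and "CARD('m) \<ge> 2"
    and "\<And>i. transpose (A i) = A i"
    and "hidden_hyperplane_convex (hom_map A b c)"
    and "sublevel A b c \<noteq> {}"
    and "convex hull (sublevel A b c) \<noteq> UNIV"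
  shows "convex hull (sublevel A b c) = (\<Inter>w\<in>good_aggregations A b c. agg_sublevel A b c w)"
proof
  show "convex hull (sublevel A b c) \<subseteq> (\<Inter>w\<in>good_aggregations A b c. agg_sublevel A b c w)"
    by (auto simp: good_aggregations_def)
  show "(\<Inter>w\<in>good_aggregations A b c. agg_sublevel A b c w) \<subseteq> convex hull (sublevel A b c)"
    using exists_good_aggregation_excluding[OF assms(3-5)] by blast
qed

end
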